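(* For finitely generated groups $G$ of orientation-preserving $C^2$ circle diffeomorphisms, property $(\star)$ does not depend on the choice of the Riemannian metric on the circle: if $G$ satisfies property $(\star)$ with respect to one Riemannian metric on $S^1$, then it satisfies property $(\star)$ with respect to every Riemannian metric on $S^1$.
   Context: Given a Riemannian metric on $S^1$, let $g'(x)>0$ denote the derivative of $g$ at $x$ measured in this metric. A point $x$ is non-expandable (with respect to this metric) if $g'(x)\le1$ for all $g\in G$; $\mathrm{NE}(G)$ is the set of such points. Property $(\star)$ with respect to this metric: $G$ acts minimally (all orbits are dense), and for every $x\in\mathrm{NE}(G)$ there exist $g_+,g_-\in G$ with $g_+(x)=g_-(x)=x$ such that, for some $\varepsilon>0$, $g_+$ has no other fixed point in $(x,x+\varepsilon)$ and $g_-$ has no other fixed point in $(x-\varepsilon,x)$. *)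

theory Defs
  imports "HOL-Analysis.Analysis" "HOL-Algebra.Bij" "HOL-Algebra.Generated_Groups"
begin

text \<open>
  The circle is the unit circle of the complex plane, oriented counterclockwise and
  parametrized by \<open>t \<mapsto> cis t\<close>. Its tangent line at \<open>x\<close> is the real line
  spanned by the positively oriented unit vector \<open>\<i> * x\<close>.
\<close>

abbreviation circle :: "complex set" where
  "circle \<equiv> sphere 0 1"

definition tangent_line :: "complex \<Rightarrow> complex set" where
  "tangent_line x = {s *\<^sub>R (\<i> * x) | s. True}"

primrec C_k_curve :: "nat \<Rightarrow> (real \<Rightarrow> 'a::real_normed_vector) \<Rightarrow> bool" where
  "C_k_curve 0 f \<longleftrightarrow> continuous_on UNIV f"
| "C_k_curve (Suc k) f \<longleftrightarrow>
     (\<exists>f'. (\<forall>t. (f has_vector_derivative f' t) (at t)) \<and> C_k_curve k f')"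

text \<open>
  Since \<open>cis\<close> is a smooth covering map onto the circle, a function on the circle is of
  class \<open>C\<^sup>k\<close> iff its pullback to the real line is.
\<close>

definition C_k_on_circle :: "nat \<Rightarrow> (complex \<Rightarrow> 'a::real_normed_vector) \<Rightarrow> bool" where
  "C_k_on_circle k f \<longleftrightarrow> C_k_curve k (\<lambda>t. f (cis t))"

text \<open>The image of the tangent vector \<open>\<i> * x\<close> under the differential of \<open>g\<close> at \<open>x\<close>.\<close>

definition push_unit_tangent :: "(complex \<Rightarrow> complex) \<Rightarrow> complex \<Rightarrow> complex" where
  "push_unit_tangent g x = vector_derivative (\<lambda>t. g (x * cis t)) (at 0)"

definition C_k_diffeo :: "nat \<Rightarrow> (complex \<Rightarrow> complex) \<Rightarrow> bool" where
  "C_k_diffeo k g \<longleftrightarrow>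
     bij_betw g circle circle \<and> C_k_on_circle k g \<and> C_k_on_circle k (inv_into circle g)"

definition orientation_preserving :: "(complex \<Rightarrow> complex) \<Rightarrow> bool" where
  "orientation_preserving g \<longleftrightarrow>
     (\<forall>x\<in>circle. \<exists>c>0. push_unit_tangent g x = c *\<^sub>R (\<i> * g x))"

text \<open>
  \<open>BijGroup circle\<close> is the group of all bijections of the circle; its elements take the
  value \<open>undefined\<close> outside the circle.
\<close>

definition C2_diffeo_group :: "(complex \<Rightarrow> complex) set \<Rightarrow> bool" where
  "C2_diffeo_group G \<longleftrightarrow>
     subgroup G (BijGroup circle) \<and> (\<forall>g\<in>G. C_k_diffeo 2 g \<and> orientation_preserving g)"

definition finitely_generated :: "('a, 'b) monoid_scheme \<Rightarrow> 'a set \<Rightarrow> bool" where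
  "finitely_generated \<Gamma> G \<longleftrightarrow> (\<exists>F. finite F \<and> F \<subseteq> carrier \<Gamma> \<and> generate \<Gamma> F = G)"

text \<open>
  \<open>m x u v\<close> is the inner product of two tangent vectors \<open>u\<close>, \<open>v\<close> at \<open>x\<close>. The last
  clause is smoothness (class \<open>C\<^sup>\<infinity>\<close>), expressed in the smooth global frame \<open>\<i> * x\<close>.
\<close>

definition riemannian_metric :: "(complex \<Rightarrow> complex \<Rightarrow> complex \<Rightarrow> real) \<Rightarrow> bool" where
  "riemannian_metric m \<longleftrightarrow>
     (\<forall>x\<in>circle.
        (\<forall>u\<in>tangent_line x. \<forall>v\<in>tangent_line x. m x u v = m x v u) \<and>
        (\<forall>u\<in>tangent_line x. \<forall>v\<in>tangent_line x. \<forall>w\<in>tangent_line x.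
           m x (u + v) w = m x u w + m x v w) \<and>
        (\<forall>a. \<forall>u\<in>tangent_line x. \<forall>v\<in>tangent_line x. m x (a *\<^sub>R u) v = a * m x u v) \<and>
        (\<forall>u\<in>tangent_line x. u \<noteq> 0 \<longrightarrow> m x u u > 0)) \<and>
     (\<forall>k. C_k_on_circle k (\<lambda>x. m x (\<i> * x) (\<i> * x)))"

definition metric_norm ::
    "(complex \<Rightarrow> complex \<Rightarrow> complex \<Rightarrow> real) \<Rightarrow> complex \<Rightarrow> complex \<Rightarrow> real" where
  "metric_norm m x v = sqrt (m x v v)"

text \<open>
  The derivative of \<open>g\<close> at \<open>x\<close> measured in \<open>m\<close> is the factor by which the differential
  scales the length of tangent vectors; as the tangent line is one-dimensional, it can be read
  off from \<open>\<i> * x\<close>.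
\<close>

definition metric_deriv ::
    "(complex \<Rightarrow> complex \<Rightarrow> complex \<Rightarrow> real) \<Rightarrow> (complex \<Rightarrow> complex) \<Rightarrow> complex \<Rightarrow> real" where
  "metric_deriv m g x = metric_norm m (g x) (push_unit_tangent g x) / metric_norm m x (\<i> * x)"

definition NE ::
    "(complex \<Rightarrow> complex \<Rightarrow> complex \<Rightarrow> real) \<Rightarrow> (complex \<Rightarrow> complex) set \<Rightarrow> complex set" where
  "NE m G = {x \<in> circle. \<forall>g\<in>G. metric_deriv m g x \<le> 1}"

definition acts_minimally :: "(complex \<Rightarrow> complex) set \<Rightarrow> bool" where
  "acts_minimally G \<longleftrightarrow> (\<forall>x\<in>circle. circle \<subseteq> closure {g x | g. g \<in> G})"

text \<open>\<open>circle_arc x a b\<close> is the open arc of points at signed angle between \<open>a\<close> and \<open>b\<close> from \<open>x\<close>.\<close>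

definition circle_arc :: "complex \<Rightarrow> real \<Rightarrow> real \<Rightarrow> complex set" where
  "circle_arc x a b = {x * cis t | t. a < t \<and> t < b}"

definition property_star ::
    "(complex \<Rightarrow> complex \<Rightarrow> complex \<Rightarrow> real) \<Rightarrow> (complex \<Rightarrow> complex) set \<Rightarrow> bool" where
  "property_star m G \<longleftrightarrow>
     acts_minimally G \<and>
     (\<forall>x\<in>NE m G. \<exists>gp\<in>G. \<exists>gm\<in>G. gp x = x \<and> gm x = x \<and>
        (\<exists>\<epsilon>>0. (\<forall>y\<in>circle_arc x 0 \<epsilon>. gp y \<noteq> y) \<and> (\<forall>y\<in>circle_arc x (-\<epsilon>) 0. gm y \<noteq> y)))"

end

theory Submission
  imports Defs
begin

text \<open>
  Let \<open>x\<close> be non-expandable for \<open>m'\<close>. Any two metrics on the circle are comparable, so the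
  \<open>m\<close>-derivatives of \<open>G\<close> at \<open>x\<close> are bounded. Moving \<open>x\<close> by group elements \<open>h\<^sub>n\<close> that almost
  realise their supremum yields, by the chain rule, points \<open>h\<^sub>n x\<close> at which all \<open>m\<close>-derivatives are
  at most \<open>1 + 1/n\<close>; they accumulate at some non-expandable point \<open>z\<close> of \<open>m\<close>. By a bounded
  distortion argument for the iterates of \<open>g\<^sub>+\<close> and \<open>g\<^sub>-\<close> (the only place where \<open>C\<^sup>2\<close> is needed),
  every point close to but different from \<open>z\<close> has a large derivative under some element of \<open>G\<close>.
  Hence \<open>h\<^sub>n x = z\<close> for some \<open>n\<close>, and conjugating the maps \<open>g\<^sub>+\<close>, \<open>g\<^sub>-\<close> of \<open>z\<close> by \<open>h\<^sub>n\<close> gives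
  the maps required at \<open>x\<close>.
\<close>

subsection \<open>Contracting fixed points on the line\<close>

text \<open>The derivative of \<open>ln f\<close> is \<open>f' / f\<close>, which is continuous and
  so bounded on a compact interval. With \<open>f\<close> the derivative of a diffeomorphism, this
  turns \<open>C\<^sup>2\<close> regularity into control of distortion.\<close>

lemma C1_ln_lipschitz:
  fixes f f' :: "real \<Rightarrow> real"
  assumes pos: "\<And>t. f t > 0" and deriv: "\<And>t. (f has_real_derivative f' t) (at t)"
    and cont: "continuous_on UNIV f'"
  obtains L where "L \<ge> 0"
    "\<And>u v. u \<in> {a..b} \<Longrightarrow> v \<in> {a..b} \<Longrightarrow> \<bar>ln (f u) - ln (f v)\<bar> \<le> L * \<bar>u - v\<bar>"
proof -
  have "continuous_on {a..b} f"
    using deriv by (intro DERIV_continuous_on[of _ f f']) (auto intro: DERIV_subset)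
  hence "continuous_on {a..b} (\<lambda>t. f' t / f t)"
    using continuous_on_subset[OF cont subset_UNIV] pos
    by (intro continuous_intros) (auto simp: less_imp_neq[symmetric])
  hence "bounded ((\<lambda>t. f' t / f t) ` {a..b})"
    by (intro compact_imp_bounded compact_continuous_image) auto
  then obtain L where L: "L > 0" "\<And>t. t \<in> {a..b} \<Longrightarrow> norm (f' t / f t) \<le> L"
    unfolding bounded_pos by auto
  have "norm (ln (f u) - ln (f v)) \<le> L * norm (u - v)" if "u \<in> {a..b}" "v \<in> {a..b}" for u v
  proof (rule field_differentiable_bound[where S = "{a..b}" and f' = "\<lambda>t. f' t / f t"])
    show "((\<lambda>t. ln (f t)) has_field_derivative f' t / f t) (at t within {a..b})" for t
      using pos[of t] by (auto intro!: derivative_eq_intros DERIV_subset[OF deriv])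
  qed (use L that in auto)
  thus ?thesis using that[of L] L(1) by simp
qed

text \<open>The product is the derivative of \<open>F ^^ n\<close> at \<open>s\<close>. Every point
  just right of \<open>t0\<close> is the image, under a high iterate, of a point of the fundamental
  domain \<open>[F a, a]\<close>. That iterate shrinks the domain to a tiny interval, so its
  derivative is small at one point of the domain by the mean value theorem, and at every point by
  bounded distortion.\<close>

lemma contraction_deriv_small:
  fixes F f f' :: "real \<Rightarrow> real"
  assumes F: "\<And>t. (F has_real_derivative f t) (at t)" and pos: "\<And>t. f t > 0"
    and f: "\<And>t. (f has_real_derivative f' t) (at t)" and cont: "continuous_on UNIV f'"
    and fix0: "F t0 = t0" and contr: "\<And>t. t0 < t \<Longrightarrow> t < t0 + \<epsilon> \<Longrightarrow> F t < t"
    and \<epsilon>: "\<epsilon> > 0" and c: "c > 0"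
  shows "\<exists>\<delta>>0. \<forall>t. t0 < t \<and> t < t0 + \<delta> \<longrightarrow>
           (\<exists>n s. (F ^^ n) s = t \<and> (\<Prod>k<n. f ((F ^^ k) s)) < c)"
proof -
  \<comment> \<open>Halving \<open>\<epsilon>\<close> keeps \<open>a\<close> strictly inside the
    interval on which \<open>contr\<close> applies. Below, \<open>x\<close> is the orbit of
    \<open>a\<close>, and \<open>D n\<close> is the derivative of the \<open>n\<close>-th
    iterate.\<close>
  define a where "a = t0 + \<epsilon> / 2"
  define x where "x n = (F ^^ n) a" for n
  define D where "D n s = (\<Prod>k<n. f ((F ^^ k) s))" for n s
  have mono: "F u < F v" if "u < v" for u v
    using DERIV_pos_imp_increasing[OF that, of F] F pos by blast
  have mono_pow: "(F ^^ n) u \<le> (F ^^ n) v" if "u \<le> v" for n u v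
    using that
  proof (induction n)
    case (Suc n)
    thus ?case using mono[of "(F ^^ n) u" "(F ^^ n) v"] by (cases "(F ^^ n) u = (F ^^ n) v") auto
  qed simp
  have Dpos: "D n s > 0" for n s
    unfolding D_def by (intro prod_pos) (auto simp: pos)
  have derivD: "((F ^^ n) has_real_derivative D n s) (at s)" for n s
  proof (induction n)
    case (Suc n)
    have "(F \<circ> (F ^^ n) has_real_derivative f ((F ^^ n) s) * D n s) (at s)"
      by (rule DERIV_chain[OF F Suc])
    thus ?case by (simp add: D_def mult.commute comp_def)
  qed (simp add: D_def id_def)
  have "a > t0" using \<epsilon> by (simp add: a_def)
  have xS: "x (Suc n) = F (x n)" for n by (simp add: x_def)
  have x_bds: "t0 < x n \<and> x n \<le> a" for n
  proof (induction n)
    case 0 thus ?case using \<open>a > t0\<close> by (simp add: x_def)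
  next
    case (Suc n)
    thus ?case using mono[of t0 "x n"] fix0 contr[of "x n"] \<epsilon> by (auto simp: xS a_def)
  qed
  have x_dec: "x (Suc n) < x n" for n
    using contr[of "x n"] x_bds[of n] \<epsilon> by (auto simp: xS a_def)
  \<comment> \<open>The decreasing orbit converges to a fixed point of \<open>F\<close> in
    \<open>[t0, a]\<close>, and \<open>contr\<close> leaves only \<open>t0\<close>.\<close>
  have x_lim: "x \<longlonglongrightarrow> t0"
  proof -
    have "decseq x" using x_dec by (intro decseq_SucI) (auto intro: less_imp_le)
    moreover have "t0 \<le> x n" for n using x_bds[of n] by simp
    ultimately obtain l where l: "x \<longlonglongrightarrow> l" "\<And>i. l \<le> x i"
      using decseq_convergent[of x t0] by metis
    have "isCont F l" using F DERIV_isCont by blast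
    hence "(\<lambda>n. F (x n)) \<longlonglongrightarrow> F l" using l(1) by (rule isCont_tendsto_compose)
    moreover have "(\<lambda>n. F (x n)) \<longlonglongrightarrow> l" using LIMSEQ_Suc[OF l(1)] by (simp add: xS)
    ultimately have "F l = l" by (rule LIMSEQ_unique)
    moreover have "t0 \<le> l" using l(1) x_bds by (intro LIMSEQ_le_const) (auto intro: less_imp_le)
    moreover have "l \<le> a" using l(2)[of 0] by (simp add: x_def)
    ultimately have "l = t0" using contr[of l] \<epsilon> by (force simp: a_def)
    with l show ?thesis by simp
  qed
  obtain L where "L \<ge> 0" and
    L: "\<And>u v. u \<in> {t0..a} \<Longrightarrow> v \<in> {t0..a} \<Longrightarrow> \<bar>ln (f u) - ln (f v)\<bar> \<le> L * \<bar>u - v\<bar>"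
    using C1_ln_lipschitz[OF pos f cont] by blast
  define K where "K = exp (L * (a - t0))"
  \<comment> \<open>The iterates of the fundamental domain lie in consecutive intervals, so their
    lengths telescope to at most \<open>a - t0\<close>. This is why \<open>K\<close> does not depend
    on the number of iterations.\<close>
  have in_J: "(F ^^ k) s \<in> {x (Suc k)..x k}" if "s \<in> {F a..a}" for k s
    using mono_pow[of "F a" s k] mono_pow[of s a k] that
    by (simp add: x_def funpow_swap1)
  have distortion: "D n u \<le> K * D n v" if "u \<in> {F a..a}" "v \<in> {F a..a}" for n u v
  proof -
    have ln_D: "ln (D n s) = (\<Sum>k<n. ln (f ((F ^^ k) s)))" for s
      unfolding D_def by (rule ln_prod) (simp_all add: less_imp_neq[OF pos, symmetric])
    have "ln (D n u) - ln (D n v) = (\<Sum>k<n. ln (f ((F ^^ k) u)) - ln (f ((F ^^ k) v)))"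
      by (simp add: ln_D sum_subtractf)
    also have "\<dots> \<le> (\<Sum>k<n. L * (x k - x (Suc k)))"
    proof (rule sum_mono)
      fix k
      have *: "(F ^^ k) s \<in> {t0..a}" if "s \<in> {F a..a}" for s
        using in_J[OF that, of k] x_bds[of k] x_bds[of "Suc k"] by auto
      have "ln (f ((F ^^ k) u)) - ln (f ((F ^^ k) v)) \<le> L * \<bar>(F ^^ k) u - (F ^^ k) v\<bar>"
        using L[OF *[OF that(1)] *[OF that(2)]] by linarith
      also have "\<dots> \<le> L * (x k - x (Suc k))"
        using in_J[OF that(1), of k] in_J[OF that(2), of k] \<open>L \<ge> 0\<close>
        by (intro mult_left_mono) auto
      finally show "ln (f ((F ^^ k) u)) - ln (f ((F ^^ k) v)) \<le> L * (x k - x (Suc k))" .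
    qed
    also have "\<dots> = L * (\<Sum>k<n. x k - x (Suc k))" by (simp add: sum_distrib_left)
    also have "\<dots> = L * (x 0 - x n)" by (simp add: sum_lessThan_telescope')
    also have "\<dots> \<le> L * (a - t0)"
      using \<open>L \<ge> 0\<close> x_bds[of n] by (intro mult_left_mono) (auto simp: x_def)
    finally have "ln (D n u) \<le> ln (K * D n v)"
      using Dpos[of n v] by (simp add: K_def ln_mult)
    moreover have "K * D n v > 0" using Dpos[of n v] by (simp add: K_def)
    ultimately show ?thesis using ln_le_cancel_iff[OF Dpos[of n u]] by blast
  qed
  have Fa: "F a < a" using x_dec[of 0] by (simp add: x_def)
  \<comment> \<open>The mean value theorem gives a point \<open>v\<close> where the derivative is
    exactly the ratio of the lengths of the image and the domain; \<open>distortion\<close> passes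
    from \<open>v\<close> to \<open>u\<close>.\<close>
  have D_bound: "D n u \<le> K * ((x n - x (Suc n)) / (a - F a))" if "u \<in> {F a..a}" for n u
  proof -
    obtain v where v: "v > F a" "v < a" "(F ^^ n) a - (F ^^ n) (F a) = (a - F a) * D n v"
      using MVT2[OF Fa, of "F ^^ n" "D n"] derivD by blast
    have "D n v = (x n - x (Suc n)) / (a - F a)"
      using v(3) Fa by (simp add: x_def funpow_swap1 field_simps)
    thus ?thesis using distortion[OF that, of v n] v by simp
  qed
  have "(\<lambda>n. K * ((x n - x (Suc n)) / (a - F a))) \<longlonglongrightarrow> K * ((t0 - t0) / (a - F a))"
    using Fa by (intro tendsto_mult tendsto_divide tendsto_diff tendsto_const x_lim
        LIMSEQ_Suc[OF x_lim]) simp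
  hence "eventually (\<lambda>n. K * ((x n - x (Suc n)) / (a - F a)) < c) sequentially"
    using c by (intro order_tendstoD(2)[rotated]) simp_all
  then obtain N where N: "\<And>n. n \<ge> N \<Longrightarrow> K * ((x n - x (Suc n)) / (a - F a)) < c"
    unfolding eventually_sequentially by blast
  have "\<exists>n s. (F ^^ n) s = t \<and> D n s < c" if t: "t0 < t" "t < x N" for t
  proof -
    have "\<exists>n. x n \<le> t"
      using order_tendstoD(2)[OF x_lim t(1)] unfolding eventually_sequentially
      by (auto intro: less_imp_le)
    \<comment> \<open>\<open>n\<close> is the first index at which the orbit has reached or passed
      \<open>t\<close>. Since \<open>t < x N\<close>, it exceeds \<open>N\<close>, so its
      predecessor \<open>k \<ge> N\<close> exists and \<open>t\<close> lies in the image of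
      \<open>[F a, a]\<close> under \<open>F ^^ k\<close>.\<close>
    define n where "n = (LEAST n. x n \<le> t)"
    have n1: "x n \<le> t" unfolding n_def by (rule LeastI_ex) fact
    have dec: "x j \<le> x i" if "i \<le> j" for i j
      using lift_Suc_antimono_le[of x, OF less_imp_le[OF x_dec] that] .
    have "n > N" using n1 t dec[of n N] by (cases "n \<le> N") auto
    then obtain k where k: "n = Suc k" "k \<ge> N" by (cases n) auto
    have n2: "t < x k"
      using not_less_Least[of k "\<lambda>n. x n \<le> t"] k(1) unfolding n_def by force
    have "\<exists>s\<ge>F a. s \<le> a \<and> (F ^^ k) s = t"
    proof (rule IVT)
      show "(F ^^ k) (F a) \<le> t" using n1 k by (simp add: x_def funpow_swap1)
      show "t \<le> (F ^^ k) a" using n2 by (simp add: x_def)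
      show "\<forall>s. F a \<le> s \<and> s \<le> a \<longrightarrow> isCont (F ^^ k) s" using DERIV_isCont[OF derivD] by blast
    qed (use Fa in simp)
    then obtain s where "s \<in> {F a..a}" "(F ^^ k) s = t" by auto
    moreover from this have "D k s < c" using D_bound[of s k] N[OF k(2)] by linarith
    ultimately show ?thesis by blast
  qed
  thus ?thesis using x_bds[of N] unfolding D_def
    by (intro exI[of _ "x N - t0"]) auto
qed


text \<open>The reflection \<open>t \<mapsto> - t\<close> conjugates \<open>F\<close> to a map
  contracting from the right and preserves the derivatives along orbits.\<close>

lemma contraction_deriv_small_left:
  fixes F f f' :: "real \<Rightarrow> real"
  assumes F: "\<And>t. (F has_real_derivative f t) (at t)" and pos: "\<And>t. f t > 0"
    and f: "\<And>t. (f has_real_derivative f' t) (at t)" and cont: "continuous_on UNIV f'"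
    and fix0: "F t0 = t0" and contr: "\<And>t. t0 - \<epsilon> < t \<Longrightarrow> t < t0 \<Longrightarrow> t < F t"
    and \<epsilon>: "\<epsilon> > 0" and c: "c > 0"
  shows "\<exists>\<delta>>0. \<forall>t. t0 - \<delta> < t \<and> t < t0 \<longrightarrow>
           (\<exists>n s. (F ^^ n) s = t \<and> (\<Prod>k<n. f ((F ^^ k) s)) < c)"
proof -
  define H where "H t = - F (- t)" for t
  have pow: "(H ^^ n) s = - (F ^^ n) (- s)" for n s
    by (induction n) (auto simp: H_def)
  have "\<exists>\<delta>>0. \<forall>t. - t0 < t \<and> t < - t0 + \<delta> \<longrightarrow>
           (\<exists>n s. (H ^^ n) s = t \<and> (\<Prod>k<n. f (- (H ^^ k) s)) < c)"
  proof (rule contraction_deriv_small[where F = H and f = "\<lambda>t. f (- t)" and \<epsilon> = \<epsilon> and f' = "\<lambda>t. - f' (- t)"])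
    show "(H has_real_derivative f (- t)) (at t)" for t
      using DERIV_minus[OF DERIV_mirror[THEN iffD1, OF F[of "- t"]]] by (simp add: H_def[abs_def])
    show "((\<lambda>t. f (- t)) has_real_derivative - f' (- t)) (at t)" for t
      using DERIV_mirror[THEN iffD1, OF f[of "- t"]] by simp
    show "continuous_on UNIV (\<lambda>t. - f' (- t))"
      by (intro continuous_intros continuous_on_compose2[OF cont]) auto
    show "H t < t" if "- t0 < t" "t < - t0 + \<epsilon>" for t
      using contr[of "- t"] that by (simp add: H_def)
  qed (use pos fix0 \<epsilon> c in \<open>simp_all add: H_def\<close>)
  then obtain \<delta> where \<delta>: "\<delta> > 0" "\<And>t. - t0 < t \<Longrightarrow> t < - t0 + \<delta> \<Longrightarrow>
      \<exists>n s. - (F ^^ n) (- s) = t \<and> (\<Prod>k<n. f ((F ^^ k) (- s))) < c"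
    unfolding pow minus_minus by (elim exE conjE) (rule that; blast)
  show ?thesis
  proof (intro exI[of _ \<delta>] conjI allI impI)
    fix t assume "t0 - \<delta> < t \<and> t < t0"
    thus "\<exists>n s. (F ^^ n) s = t \<and> (\<Prod>k<n. f ((F ^^ k) s)) < c"
      using \<delta>(2)[of "- t"] by fastforce
  qed fact
qed

subsection \<open>Derivatives on the circle\<close>

text \<open>This is the derivative with respect to arc length. For an orientation-preserving map the
  quotient is already a positive real, and \<open>Re\<close> only changes its type.\<close>

definition angular_deriv :: "(complex \<Rightarrow> complex) \<Rightarrow> complex \<Rightarrow> real" where
  "angular_deriv g x = Re (push_unit_tangent g x / (\<i> * g x))"

text \<open>\<open>F\<close> is a lift of \<open>g\<close> through the covering \<open>cis\<close>.
  The derivative is part of the notion, so that calculus on the circle becomes calculus on the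
  line.\<close>

definition angular_lift :: "(complex \<Rightarrow> complex) \<Rightarrow> (real \<Rightarrow> real) \<Rightarrow> bool" where
  "angular_lift g F \<longleftrightarrow> (\<forall>t. g (cis t) = cis (F t)) \<and>
     (\<forall>t. (F has_real_derivative angular_deriv g (cis t)) (at t))"

lemma push_unit_tangent_cis:
  assumes "((\<lambda>t. g (cis t)) has_vector_derivative d) (at t)"
  shows "push_unit_tangent g (cis t) = d"
proof -
  have "((+) t has_vector_derivative 1) (at 0)"
    by (auto intro!: derivative_eq_intros)
  hence "((\<lambda>s. g (cis (t + s))) has_vector_derivative d) (at 0)"
    using vector_diff_chain_at[of "(+) t" 1 0 "\<lambda>t. g (cis t)" d] assms by (simp add: o_def)
  thus ?thesis
    by (simp add: push_unit_tangent_def cis_mult vector_derivative_at)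
qed

lemma has_vector_derivative_cis:
  assumes "(F has_real_derivative c) (at t)"
  shows "((\<lambda>t. cis (F t)) has_vector_derivative c *\<^sub>R (\<i> * cis (F t))) (at t)"
  using assms unfolding has_vector_derivative_def has_field_derivative_def
  by (auto intro!: derivative_eq_intros simp: scaleR_conv_of_real mult_ac)

lemma angular_deriv_eqI:
  assumes "\<And>t. g (cis t) = cis (F t)" and "(F has_real_derivative c) (at t)"
  shows "angular_deriv g (cis t) = c"
  using push_unit_tangent_cis[of g "c *\<^sub>R (\<i> * cis (F t))" t]
    has_vector_derivative_cis[OF assms(2)] assms(1)
  by (simp add: angular_deriv_def scaleR_conv_of_real)

text \<open>The lift is obtained by integrating the angular derivative. Its graph can be made to
  pass through any prescribed \<open>(t0, t1)\<close> over the map, in particular through a fixed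
  point of the lift when \<open>g\<close> fixes \<open>cis t0\<close>.\<close>

lemma C2_angular_lift:
  assumes g: "C_k_diffeo 2 g" "orientation_preserving g" and t01: "g (cis t0) = cis t1"
  obtains F f' where "angular_lift g F" "F t0 = t1"
    "\<And>t. ((\<lambda>t. angular_deriv g (cis t)) has_real_derivative f' t) (at t)"
    "continuous_on UNIV f'"
proof -
  define h where "h t = g (cis t)" for t
  obtain h' h'' where h': "\<And>t. (h has_vector_derivative h' t) (at t)"
    and h'': "\<And>t. (h' has_vector_derivative h'' t) (at t)" and cont'': "continuous_on UNIV h''"
    using g(1) unfolding C_k_diffeo_def C_k_on_circle_def numeral_2_eq_2 h_def[abs_def]
    by auto
  have norm_h: "norm (h t) = 1" for t
    using g(1) unfolding C_k_diffeo_def h_def by (force simp: bij_betw_def)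
  have hcnj: "h t * cnj (h t) = 1" for t
    using norm_h[of t] by (simp add: complex_norm_square[symmetric])
  have push: "push_unit_tangent g (cis t) = h' t" for t
    using h'[of t] unfolding h_def[abs_def] by (rule push_unit_tangent_cis)
  define f where "f t = angular_deriv g (cis t)" for t
  have h'_eq: "h' t = f t *\<^sub>R (\<i> * h t)" for t
  proof -
    have "cis t \<in> circle" by simp
    then obtain c where c: "h' t = c *\<^sub>R (\<i> * h t)"
      using g(2) unfolding orientation_preserving_def push[symmetric] h_def by blast
    moreover have "h t \<noteq> 0" using norm_h[of t] by auto
    ultimately have "f t = c"
      by (simp add: f_def angular_deriv_def push h_def[symmetric] scaleR_conv_of_real)
    with c show ?thesis by simp
  qed
  \<comment> \<open>As \<open>h\<close> has modulus 1, multiplying \<open>h'\<close> by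
    \<open>cnj (h t)\<close> leaves \<open>f t\<close> times \<open>\<i>\<close>. This formula makes
    \<open>f\<close> differentiable, because \<open>h'\<close> is.\<close>
  have f_eq: "f t = Im (h' t * cnj (h t))" for t
    using hcnj[of t] by (simp add: h'_eq scaleR_conv_of_real mult.assoc)
  define f' where "f' t = Im (h' t * cnj (h' t) + h'' t * cnj (h t))" for t
  have f': "(f has_real_derivative f' t) (at t)" for t
  proof -
    have "((\<lambda>t. h' t * cnj (h t)) has_vector_derivative
            h' t * cnj (h' t) + h'' t * cnj (h t)) (at t)"
      by (intro has_vector_derivative_mult h' h'' has_vector_derivative_cnj)
    thus ?thesis unfolding f'_def f_eq[abs_def] by (simp only: has_vector_derivative_complex_iff)
  qed
  have cont_h: "continuous_on UNIV h" "continuous_on UNIV h'"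
    using h' h'' by (auto intro!: continuous_at_imp_continuous_on
        dest: has_vector_derivative_continuous)
  have cont_f': "continuous_on UNIV f'"
    unfolding f'_def[abs_def] by (intro continuous_intros cont_h cont'')
  have "\<exists>F. \<forall>t::real. -\<infinity> < ereal t \<longrightarrow> ereal t < \<infinity> \<longrightarrow> (F has_vector_derivative f t) (at t)"
    by (rule einterval_antiderivative) (use f' DERIV_isCont in auto)
  then obtain F0 where F0: "\<And>t. (F0 has_real_derivative f t) (at t)"
    by (auto simp: has_real_derivative_iff_has_vector_derivative)
  define F where "F t = F0 t - F0 t0 + t1" for t
  have F: "(F has_real_derivative f t) (at t)" for t
    unfolding F_def by (auto intro!: derivative_eq_intros F0)
  \<comment> \<open>\<open>h\<close> and \<open>cis \<circ> F\<close> satisfy the same linear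
    differential equation, so their quotient is constant; the choice of the additive constant in
    \<open>F\<close> makes it 1 at \<open>t0\<close>.\<close>
  have "((\<lambda>t. h t * cis (- F t)) has_vector_derivative 0) (at t)" for t
    using has_vector_derivative_mult[OF h'[of t]
        has_vector_derivative_cis[OF DERIV_minus[OF F[of t]]]]
    by (simp add: h'_eq scaleR_conv_of_real algebra_simps)
  hence "(\<lambda>t. h t * cis (- F t)) constant_on UNIV"
    by (intro has_derivative_zero_connected_constant_on[where K = "{}"])
      (auto simp: has_vector_derivative_def intro!: continuous_at_imp_continuous_on
        dest: has_derivative_continuous)
  then obtain C where C: "h t * cis (- F t) = C" for t
    unfolding constant_on_def by blast
  have "C = 1" using C[of t0] t01 by (simp add: F_def h_def cis_mult)
  hence "h t * cis (- F t) * cis (F t) = cis (F t)" for t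
    by (simp add: C)
  hence "h t = cis (F t)" for t by (simp add: cis_mult mult.assoc)
  with F have "angular_lift g F" by (simp add: angular_lift_def h_def f_def)
  thus ?thesis
    using f' cont_f' that[of F f'] by (simp add: F_def f_def[abs_def])
qed

lemma circle_cis_Arg: "x \<in> circle \<Longrightarrow> cis (Arg x) = x"
  by (cases "x = 0") (auto simp: cis_Arg sgn_div_norm)

lemma push_unit_tangent_eq:
  assumes "orientation_preserving g" "x \<in> circle" "g x \<in> circle"
  shows "angular_deriv g x > 0" "push_unit_tangent g x = angular_deriv g x *\<^sub>R (\<i> * g x)"
proof -
  obtain c where "c > 0" "push_unit_tangent g x = c *\<^sub>R (\<i> * g x)"
    using assms unfolding orientation_preserving_def by blast
  moreover have "g x \<noteq> 0" using assms by auto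
  ultimately show "angular_deriv g x > 0" "push_unit_tangent g x = angular_deriv g x *\<^sub>R (\<i> * g x)"
    by (simp_all add: angular_deriv_def scaleR_conv_of_real)
qed

lemma metric_norm_scaleR:
  assumes "riemannian_metric m" "x \<in> circle" "u \<in> tangent_line x" "c \<ge> 0"
  shows "metric_norm m x (c *\<^sub>R u) = c * metric_norm m x u"
proof -
  have cu: "c *\<^sub>R u \<in> tangent_line x"
    using assms(3) unfolding tangent_line_def by (auto intro: exI[of _ "c * _"])
  have "m x (c *\<^sub>R u) (c *\<^sub>R u) = c * m x u (c *\<^sub>R u)"
    using assms cu unfolding riemannian_metric_def by blast
  \<comment> \<open>Linearity is postulated in the first slot only, so the second factor
    \<open>c\<close> is pulled out after a swap by symmetry.\<close>
  also have "m x u (c *\<^sub>R u) = m x (c *\<^sub>R u) u"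
    using assms cu unfolding riemannian_metric_def by blast
  also have "\<dots> = c * m x u u"
    using assms cu unfolding riemannian_metric_def by blast
  finally show ?thesis using assms(4) by (simp add: metric_norm_def real_sqrt_mult)
qed

lemma i_mult_in_tangent_line: "\<i> * x \<in> tangent_line x"
  unfolding tangent_line_def by (auto intro: exI[of _ 1])

lemma metric_norm_unit_pos:
  assumes "riemannian_metric m" "x \<in> circle"
  shows "metric_norm m x (\<i> * x) > 0"
proof -
  have "\<i> * x \<noteq> 0" using assms(2) by auto
  thus ?thesis
    using assms i_mult_in_tangent_line[of x]
    unfolding riemannian_metric_def metric_norm_def real_sqrt_gt_0_iff by blast
qed

lemma continuous_metric_norm_unit:
  assumes "riemannian_metric m"
  shows "continuous_on UNIV (\<lambda>t. metric_norm m (cis t) (\<i> * cis t))"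
proof -
  have "C_k_on_circle 0 (\<lambda>x. m x (\<i> * x) (\<i> * x))"
    using assms unfolding riemannian_metric_def by blast
  thus ?thesis
    unfolding metric_norm_def C_k_on_circle_def by (auto intro!: continuous_intros)
qed

text \<open>A positive continuous function on a compact set has positive bounds. They make every
  metric comparable with arc length, hence any two metrics with each other.\<close>

lemma metric_norm_unit_bounds:
  assumes "riemannian_metric m"
  obtains a b where "a > 0" "b > 0" "\<And>x. x \<in> circle \<Longrightarrow> a \<le> metric_norm m x (\<i> * x)"
    "\<And>x. x \<in> circle \<Longrightarrow> metric_norm m x (\<i> * x) \<le> b"
proof -
  define r where "r t = metric_norm m (cis t) (\<i> * cis t)" for t
  have cont: "continuous_on {-pi..pi} r"
    unfolding r_def by (rule continuous_on_subset[OF continuous_metric_norm_unit[OF assms]]) simp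
  have ne: "{-pi..pi} \<noteq> {}" using pi_gt_zero by (simp add: less_imp_le)
  obtain s where s: "\<And>t. t \<in> {-pi..pi} \<Longrightarrow> r s \<le> r t"
    using continuous_attains_inf[OF compact_Icc ne cont] by blast
  obtain u where u: "\<And>t. t \<in> {-pi..pi} \<Longrightarrow> r t \<le> r u"
    using continuous_attains_sup[OF compact_Icc ne cont] by blast
  have pos: "r t > 0" for t unfolding r_def by (rule metric_norm_unit_pos[OF assms]) simp
  have Arg: "Arg x \<in> {-pi..pi}" for x using Arg_bounded[of x] by simp
  have eq: "metric_norm m x (\<i> * x) = r (Arg x)" if "x \<in> circle" for x
    using circle_cis_Arg[OF that] by (simp add: r_def)
  show ?thesis
    by (rule that[of "r s" "r u"]) (use pos s[OF Arg] u[OF Arg] eq in auto)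
qed

subsection \<open>Groups of circle diffeomorphisms\<close>

locale C2_circle_group =
  fixes G :: "(complex \<Rightarrow> complex) set"
  assumes group: "C2_diffeo_group G"
begin

lemma C2: "g \<in> G \<Longrightarrow> C_k_diffeo 2 g"
  and orient: "g \<in> G \<Longrightarrow> orientation_preserving g"
  and subgrp: "subgroup G (BijGroup circle)"
  using group unfolding C2_diffeo_group_def by auto

lemma bij: "g \<in> G \<Longrightarrow> bij_betw g circle circle"
  using C2 unfolding C_k_diffeo_def by blast

lemma maps_circle: "g \<in> G \<Longrightarrow> x \<in> circle \<Longrightarrow> g x \<in> circle"
  using bij bij_betwE by blast

lemma eq_iff: "g \<in> G \<Longrightarrow> x \<in> circle \<Longrightarrow> y \<in> circle \<Longrightarrow> g x = g y \<longleftrightarrow> x = y"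
  using bij unfolding bij_betw_def inj_on_def by blast

lemma Bij: "g \<in> G \<Longrightarrow> g \<in> Bij circle"
  using subgroup.subset[OF subgrp] by (auto simp: BijGroup_def)

text \<open>Multiplication in \<open>BijGroup circle\<close> is composition restricted to the
  circle. This lemma and the next ones replace the group operations by pointwise equations on the
  circle.\<close>

lemma ex_id: "\<exists>e\<in>G. \<forall>x\<in>circle. e x = x"
  using subgroup.one_closed[OF subgrp]
  by (intro bexI[of _ "\<one>\<^bsub>BijGroup circle\<^esub>"]) (auto simp: BijGroup_def)

lemma ex_comp:
  assumes "f \<in> G" "g \<in> G"
  shows "\<exists>h\<in>G. \<forall>x\<in>circle. h x = f (g x)"
  using subgroup.m_closed[OF subgrp assms] Bij assms
  by (intro bexI[of _ "f \<otimes>\<^bsub>BijGroup circle\<^esub> g"]) (auto simp: BijGroup_def compose_def)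

lemma ex_inv:
  assumes "f \<in> G"
  shows "\<exists>h\<in>G. \<forall>x\<in>circle. h (f x) = x \<and> f (h x) = x"
proof -
  have "restrict (inv_into circle f) circle \<in> G"
    using subgroup.m_inv_closed[OF subgrp assms] inv_BijGroup[OF Bij[OF assms]] by simp
  moreover have "inv_into circle f (f x) = x \<and> f (inv_into circle f x) = x" if "x \<in> circle" for x
    using bij[OF assms] that by (simp add: bij_betw_inv_into_left bij_betw_inv_into_right)
  ultimately show ?thesis using maps_circle[OF assms] by (intro bexI) auto
qed

text \<open>\<open>k\<close> is the conjugate of \<open>f\<close> by \<open>h\<close>. The equation
  is kept free of inverses, since this form carries fixed points back along
  \<open>h\<close>.\<close>

lemma ex_conj:
  assumes "f \<in> G" "h \<in> G"
  shows "\<exists>k\<in>G. \<forall>x\<in>circle. h (k x) = f (h x)"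
proof -
  obtain h' where h': "h' \<in> G" "\<And>x. x \<in> circle \<Longrightarrow> h (h' x) = x" using ex_inv[OF assms(2)] by blast
  obtain fh where fh: "fh \<in> G" "\<And>x. x \<in> circle \<Longrightarrow> fh x = f (h x)" using ex_comp[OF assms] by blast
  obtain k where k: "k \<in> G" "\<And>x. x \<in> circle \<Longrightarrow> k x = h' (fh x)" using ex_comp[OF h'(1) fh(1)] by blast
  show ?thesis using k h'(2) fh maps_circle assms by (intro bexI[of _ k]) auto
qed

section \<open>Lifts of group elements and the chain rule\<close>

lemma angular_pos: "g \<in> G \<Longrightarrow> x \<in> circle \<Longrightarrow> angular_deriv g x > 0"
  using push_unit_tangent_eq(1) orient maps_circle by blast

lemma lift:
  assumes "g \<in> G" "g (cis t0) = cis t1"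
  obtains F f' where "angular_lift g F" "F t0 = t1"
    "\<And>t. ((\<lambda>t. angular_deriv g (cis t)) has_real_derivative f' t) (at t)"
    "continuous_on UNIV f'"
  by (rule C2_angular_lift[OF C2[OF assms(1)] orient[OF assms(1)] assms(2)]) (rule that)

lemma ex_C1_angular_deriv:
  assumes "g \<in> G"
  obtains f' where "\<And>t. ((\<lambda>t. angular_deriv g (cis t)) has_real_derivative f' t) (at t)"
    "continuous_on UNIV f'"
proof -
  have "g (cis 0) = cis (Arg (g (cis 0)))"
    using circle_cis_Arg[OF maps_circle[OF assms]] by simp
  thus ?thesis by (rule lift[OF assms]) (rule that)
qed

lemma ex_lift:
  assumes "g \<in> G"
  obtains F where "angular_lift g F"
proof -
  have "g (cis 0) = cis (Arg (g (cis 0)))"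
    using circle_cis_Arg[OF maps_circle[OF assms]] by simp
  thus ?thesis by (rule lift[OF assms]) (rule that)
qed

text \<open>The composite of two lifts represents \<open>h\<close>, so the chain rule on the line
  applies. Since \<open>h\<close> is prescribed on the circle only, it may also be the plain
  identity function, as in the next lemma.\<close>

lemma angular_deriv_comp:
  assumes "f \<in> G" "g \<in> G" and h: "\<And>x. x \<in> circle \<Longrightarrow> h x = f (g x)" and x: "x \<in> circle"
  shows "angular_deriv h x = angular_deriv f (g x) * angular_deriv g x"
proof -
  obtain F1 where F1: "angular_lift f F1" using ex_lift[OF assms(1)] .
  obtain F2 where F2: "angular_lift g F2" using ex_lift[OF assms(2)] .
  have "h (cis t) = cis (F1 (F2 t))" for t
    using F1 F2 h by (simp add: angular_lift_def)
  moreover have "((\<lambda>t. F1 (F2 t)) has_real_derivative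
      angular_deriv f (cis (F2 t)) * angular_deriv g (cis t)) (at t)" for t
    using F1 F2 by (intro DERIV_chain2) (auto simp: angular_lift_def)
  ultimately have "angular_deriv h (cis t) =
      angular_deriv f (cis (F2 t)) * angular_deriv g (cis t)" for t
    by (rule angular_deriv_eqI)
  from this[of "Arg x"] F2 show ?thesis
    using circle_cis_Arg[OF x] by (metis angular_lift_def)
qed

lemma angular_deriv_inverse:
  assumes "f \<in> G" "g \<in> G" and inv: "\<And>x. x \<in> circle \<Longrightarrow> f (g x) = x" and x: "x \<in> circle"
  shows "angular_deriv f (g x) * angular_deriv g x = 1"
proof -
  have "angular_deriv (\<lambda>x. x) (cis (Arg x)) = 1"
    by (rule angular_deriv_eqI[where F = "\<lambda>t. t"]) simp_all
  moreover have "angular_deriv (\<lambda>x. x) x = angular_deriv f (g x) * angular_deriv g x"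
    using inv x by (intro angular_deriv_comp assms) auto
  ultimately show ?thesis using circle_cis_Arg[OF x] by simp
qed

lemma lift_strict_mono:
  assumes "g \<in> G" "angular_lift g F" "s < t"
  shows "F s < F t"
  using DERIV_pos_imp_increasing[OF assms(3), of F] assms angular_pos
  unfolding angular_lift_def by (metis norm_cis mem_sphere_0)

lemma lift_isCont: "angular_lift g F \<Longrightarrow> isCont F t"
  unfolding angular_lift_def by (elim conjE allE[of _ t]) (rule DERIV_isCont)

text \<open>The inverse map is lifted through the same fixed point \<open>t0\<close>. By the chain
  rule \<open>H (F t) - t\<close> has derivative 0, and it vanishes at \<open>t0\<close>.\<close>

lemma ex_inverse_lift:
  assumes "g \<in> G" "angular_lift g F" "F t0 = t0"
  obtains h H where "h \<in> G" "angular_lift h H" "H t0 = t0" "\<And>t. H (F t) = t"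
proof -
  obtain h where h: "h \<in> G" "\<And>x. x \<in> circle \<Longrightarrow> h (g x) = x"
    using ex_inv[OF assms(1)] by blast
  have "g (cis t0) = cis t0" using assms by (simp add: angular_lift_def)
  hence "h (cis t0) = cis t0" using h(2)[of "cis t0"] by simp
  then obtain H where H: "angular_lift h H" "H t0 = t0" by (rule lift[OF h(1)]) (rule that)
  have "((\<lambda>t. H (F t) - t) has_real_derivative 0) (at t)" for t
  proof -
    have "((\<lambda>t. H (F t)) has_real_derivative
        angular_deriv h (cis (F t)) * angular_deriv g (cis t)) (at t)"
      using H assms by (intro DERIV_chain2) (auto simp: angular_lift_def)
    moreover have "angular_deriv h (cis (F t)) * angular_deriv g (cis t) = 1"
      using angular_deriv_inverse[OF h(1) assms(1) h(2), of "cis t"] assms(2)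
      by (simp add: angular_lift_def)
    ultimately show ?thesis by (auto intro!: derivative_eq_intros)
  qed
  hence "H (F t) - t = H (F t0) - t0" for t by (intro DERIV_isconst_all) auto
  hence "H (F t) = t" for t using assms H by simp
  with h H that show ?thesis by blast
qed

section \<open>Expansion near one-sidedly isolated fixed points\<close>

text \<open>\<open>h\<close> is the \<open>n\<close>-th iterate of the inverse of \<open>g\<close>;
  its derivative at the end of an orbit segment is the reciprocal of the derivative of the iterate
  at the start.\<close>

lemma iterate_inverse_deriv:
  assumes "g \<in> G" "angular_lift g F"
  shows "\<exists>h\<in>G. angular_deriv h (cis ((F ^^ n) s)) *
    (\<Prod>k<n. angular_deriv g (cis ((F ^^ k) s))) = 1"
proof (induction n)
  case 0
  obtain e where e: "e \<in> G" "\<And>x. x \<in> circle \<Longrightarrow> e x = x" using ex_id by blast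
  \<comment> \<open>On the circle \<open>e\<close> is its own inverse, so its derivative squares to
    1; positivity excludes -1.\<close>
  have "angular_deriv e (e (cis s)) * angular_deriv e (cis s) = 1"
    using e by (intro angular_deriv_inverse) auto
  hence "(angular_deriv e (cis s))\<^sup>2 = 1" by (simp add: e power2_eq_square)
  moreover have "angular_deriv e (cis s) > 0" using e by (intro angular_pos) auto
  ultimately have "angular_deriv e (cis s) = 1" by (simp add: power2_eq_1_iff)
  thus ?case using e by auto
next
  case (Suc n)
  then obtain h where h: "h \<in> G" "angular_deriv h (cis ((F ^^ n) s)) *
    (\<Prod>k<n. angular_deriv g (cis ((F ^^ k) s))) = 1" by blast
  obtain g' where g': "g' \<in> G" "\<And>x. x \<in> circle \<Longrightarrow> g' (g x) = x"
    using ex_inv[OF assms(1)] by blast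
  obtain k where k: "k \<in> G" "\<And>x. x \<in> circle \<Longrightarrow> k x = h (g' x)"
    using ex_comp[OF h(1) g'(1)] by blast
  define y where "y = cis ((F ^^ n) s)"
  have y: "y \<in> circle" by (simp add: y_def)
  have gy: "g y = cis ((F ^^ Suc n) s)" using assms(2) by (simp add: y_def angular_lift_def)
  have "angular_deriv k (g y) = angular_deriv h (g' (g y)) * angular_deriv g' (g y)"
    using k h g' maps_circle[OF assms(1) y] by (intro angular_deriv_comp) auto
  hence "angular_deriv k (g y) * angular_deriv g y =
      angular_deriv h y * (angular_deriv g' (g y) * angular_deriv g y)"
    using g'(2)[OF y] by simp
  also have "\<dots> = angular_deriv h y"
    using angular_deriv_inverse[OF g'(1) assms(1) g'(2) y] by simp
  finally have step: "angular_deriv k (g y) * angular_deriv g y = angular_deriv h y" .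
  have "angular_deriv k (g y) * ((\<Prod>k<n. angular_deriv g (cis ((F ^^ k) s))) * angular_deriv g y)
      = (angular_deriv k (g y) * angular_deriv g y) * (\<Prod>k<n. angular_deriv g (cis ((F ^^ k) s)))"
    by (simp only: mult_ac)
  also have "\<dots> = 1" unfolding step using h(2) by (simp only: y_def)
  finally have "angular_deriv k (g y) * ((\<Prod>k<n. angular_deriv g (cis ((F ^^ k) s))) *
      angular_deriv g y) = 1" .
  thus ?case
    by (intro bexI[OF _ k(1)]) (simp add: gy[symmetric] y_def[symmetric] del: funpow.simps)
qed

lemma ex_large_deriv:
  assumes "g \<in> G" "angular_lift g F" and C: "C > 0"
    and F: "(F ^^ n) s = t" "(\<Prod>k<n. angular_deriv g (cis ((F ^^ k) s))) < 1 / C"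
  shows "\<exists>h\<in>G. angular_deriv h (cis t) > C"
proof -
  define P where "P = (\<Prod>k<n. angular_deriv g (cis ((F ^^ k) s)))"
  obtain h where h: "h \<in> G" "angular_deriv h (cis t) * P = 1"
    using iterate_inverse_deriv[OF assms(1,2), of n s] F(1) unfolding P_def by blast
  have "angular_deriv h (cis t) > 0" by (rule angular_pos[OF h(1)]) simp
  hence "1 < angular_deriv h (cis t) * (1 / C)"
    using mult_strict_left_mono[OF F(2)] h(2) unfolding P_def[symmetric] by metis
  thus ?thesis using h(1) C by (auto simp: field_simps)
qed

text \<open>\<open>F t - t\<close> does not vanish on the connected set \<open>S\<close>, so it has
  constant sign there. Passing to the inverse reverses the direction of motion, so one of the two
  maps moves \<open>S\<close> in the desired direction.\<close>

lemma ex_contracting: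
  assumes g: "g \<in> G" "g (cis t0) = cis t0" and S: "connected S"
    and nofix: "\<forall>t\<in>S. g (cis t) \<noteq> cis t"
  shows "\<exists>h H. h \<in> G \<and> angular_lift h H \<and> H t0 = t0 \<and> (\<forall>t\<in>S. H t < t)"
    and "\<exists>h H. h \<in> G \<and> angular_lift h H \<and> H t0 = t0 \<and> (\<forall>t\<in>S. t < H t)"
proof -
  obtain F where F: "angular_lift g F" "F t0 = t0" by (rule lift[OF g]) (rule that)
  obtain h H where H: "h \<in> G" "angular_lift h H" "H t0 = t0" and HF: "\<And>t. H (F t) = t"
    by (rule ex_inverse_lift[OF g(1) F]) (rule that)
  have ne: "F t \<noteq> t" if "t \<in> S" for t
    using nofix that F(1) by (metis angular_lift_def)
  have cases: "(\<forall>t\<in>S. F t < t) \<or> (\<forall>t\<in>S. t < F t)"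
  proof (rule ccontr)
    assume "\<not> ?thesis"
    then obtain u v where uv: "u \<in> S" "F u - u \<ge> 0" "v \<in> S" "F v - v \<le> 0"
      by (auto simp: not_less)
    have "connected ((\<lambda>t. F t - t) ` S)"
      using lift_isCont[OF F(1)] S
      by (intro connected_continuous_image continuous_intros continuous_at_imp_continuous_on) auto
    hence "0 \<in> (\<lambda>t. F t - t) ` S"
      using connectedD_interval[of "(\<lambda>t. F t - t) ` S" "F v - v" "F u - u" 0] uv by blast
    thus False using ne by auto
  qed
  have less: "H t < t" if "t < F t" for t
    using lift_strict_mono[OF H(1,2) that] HF[of t] by simp
  have greater: "t < H t" if "F t < t" for t
    using lift_strict_mono[OF H(1,2) that] HF[of t] by simp
  have cases': "(\<forall>t\<in>S. F t < t) \<and> (\<forall>t\<in>S. t < H t) \<or> (\<forall>t\<in>S. H t < t) \<and> (\<forall>t\<in>S. t < F t)"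
    using cases
  proof
    assume *: "\<forall>t\<in>S. F t < t"
    have "\<forall>t\<in>S. t < H t"
    proof
      fix t assume "t \<in> S"
      thus "t < H t" using * by (intro greater) simp
    qed
    with * show ?thesis by simp
  next
    assume *: "\<forall>t\<in>S. t < F t"
    have "\<forall>t\<in>S. H t < t"
    proof
      fix t assume "t \<in> S"
      thus "H t < t" using * by (intro less) simp
    qed
    with * show ?thesis by simp
  qed
  show "\<exists>h H. h \<in> G \<and> angular_lift h H \<and> H t0 = t0 \<and> (\<forall>t\<in>S. H t < t)"
  proof (cases "\<forall>t\<in>S. F t < t")
    case True
    thus ?thesis using g(1) F by (intro exI[of _ g] exI[of _ F]) simp
  next
    case False
    hence "\<forall>t\<in>S. H t < t" using cases' by argo
    thus ?thesis using H by (intro exI[of _ h] exI[of _ H]) simp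
  qed
  show "\<exists>h H. h \<in> G \<and> angular_lift h H \<and> H t0 = t0 \<and> (\<forall>t\<in>S. t < H t)"
  proof (cases "\<forall>t\<in>S. t < F t")
    case True
    thus ?thesis using g(1) F by (intro exI[of _ g] exI[of _ F]) simp
  next
    case False
    hence "\<forall>t\<in>S. t < H t" using cases' by argo
    thus ?thesis using H by (intro exI[of _ h] exI[of _ H]) simp
  qed
qed

text \<open>\<open>g\<close> or its inverse contracts a right neighbourhood of \<open>t0\<close>
  towards \<open>t0\<close>. Nearby points end long orbit segments with derivative below
  \<open>1 / C\<close>, and going back along them expands by more than \<open>C\<close>.\<close>

lemma ex_large_deriv_right:
  assumes g: "g \<in> G" "g (cis t0) = cis t0" and \<epsilon>: "\<epsilon> > 0"
    and nofix: "\<forall>y\<in>circle_arc (cis t0) 0 \<epsilon>. g y \<noteq> y" and C: "C > 0"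
  shows "\<exists>\<delta>>0. \<forall>t. t0 < t \<and> t < t0 + \<delta> \<longrightarrow> (\<exists>h\<in>G. angular_deriv h (cis t) > C)"
proof -
  have "g (cis t) \<noteq> cis t" if "t \<in> {t0<..<t0 + \<epsilon>}" for t
    using that by (intro bspec[OF nofix])
      (auto simp: circle_arc_def cis_mult intro!: exI[of _ "t - t0"])
  hence "\<forall>t\<in>{t0<..<t0 + \<epsilon>}. g (cis t) \<noteq> cis t" by blast
  from ex_contracting(1)[OF g connected_Ioo[of t0 "t0 + \<epsilon>"] this]
  obtain h H where h: "h \<in> G" "angular_lift h H" "H t0 = t0" and H: "\<forall>t\<in>{t0<..<t0 + \<epsilon>}. H t < t"
    by (elim exE conjE) (rule that)
  obtain f' where f': "\<And>t. ((\<lambda>t. angular_deriv h (cis t)) has_real_derivative f' t) (at t)"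
    "continuous_on UNIV f'"
    by (rule ex_C1_angular_deriv[OF h(1)]) (rule that)
  have "\<exists>\<delta>>0. \<forall>t. t0 < t \<and> t < t0 + \<delta> \<longrightarrow>
      (\<exists>n s. (H ^^ n) s = t \<and> (\<Prod>k<n. angular_deriv h (cis ((H ^^ k) s))) < 1 / C)"
  proof (rule contraction_deriv_small[where F = H and f = "\<lambda>t. angular_deriv h (cis t)"
        and f' = f' and \<epsilon> = \<epsilon>])
    show "(H has_real_derivative angular_deriv h (cis t)) (at t)" for t
      using h(2) by (simp add: angular_lift_def)
    show "angular_deriv h (cis t) > 0" for t
      by (rule angular_pos[OF h(1)]) simp
    show "H t < t" if "t0 < t" "t < t0 + \<epsilon>" for t
      using H that by simp
    show "1 / C > 0" using C by simp
  qed (fact h f' \<epsilon>)+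
  then obtain \<delta> where \<delta>: "\<delta> > 0" "\<forall>t. t0 < t \<and> t < t0 + \<delta> \<longrightarrow>
      (\<exists>n s. (H ^^ n) s = t \<and> (\<Prod>k<n. angular_deriv h (cis ((H ^^ k) s))) < 1 / C)"
    by (elim exE conjE) (rule that)
  show ?thesis
  proof (intro exI[of _ \<delta>] conjI allI impI)
    fix t assume "t0 < t \<and> t < t0 + \<delta>"
    with \<delta>(2) obtain n s where "(H ^^ n) s = t"
      "(\<Prod>k<n. angular_deriv h (cis ((H ^^ k) s))) < 1 / C"
      by (elim allE[of _ t] impE exE conjE) (simp, rule that)
    thus "\<exists>h\<in>G. angular_deriv h (cis t) > C" by (rule ex_large_deriv[OF h(1,2) C])
  qed (fact \<delta>(1))
qed

text \<open>Mirror image of the previous argument: now the map that moves points upwards is the one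
  contracting towards \<open>t0\<close>.\<close>

lemma ex_large_deriv_left:
  assumes g: "g \<in> G" "g (cis t0) = cis t0" and \<epsilon>: "\<epsilon> > 0"
    and nofix: "\<forall>y\<in>circle_arc (cis t0) (-\<epsilon>) 0. g y \<noteq> y" and C: "C > 0"
  shows "\<exists>\<delta>>0. \<forall>t. t0 - \<delta> < t \<and> t < t0 \<longrightarrow> (\<exists>h\<in>G. angular_deriv h (cis t) > C)"
proof -
  have "g (cis t) \<noteq> cis t" if "t \<in> {t0 - \<epsilon><..<t0}" for t
    using that by (intro bspec[OF nofix])
      (auto simp: circle_arc_def cis_mult intro!: exI[of _ "t - t0"])
  hence "\<forall>t\<in>{t0 - \<epsilon><..<t0}. g (cis t) \<noteq> cis t" by blast
  from ex_contracting(2)[OF g connected_Ioo[of "t0 - \<epsilon>" t0] this]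
  obtain h H where h: "h \<in> G" "angular_lift h H" "H t0 = t0" and H: "\<forall>t\<in>{t0 - \<epsilon><..<t0}. t < H t"
    by (elim exE conjE) (rule that)
  obtain f' where f': "\<And>t. ((\<lambda>t. angular_deriv h (cis t)) has_real_derivative f' t) (at t)"
    "continuous_on UNIV f'"
    by (rule ex_C1_angular_deriv[OF h(1)]) (rule that)
  have "\<exists>\<delta>>0. \<forall>t. t0 - \<delta> < t \<and> t < t0 \<longrightarrow>
      (\<exists>n s. (H ^^ n) s = t \<and> (\<Prod>k<n. angular_deriv h (cis ((H ^^ k) s))) < 1 / C)"
  proof (rule contraction_deriv_small_left[where F = H and f = "\<lambda>t. angular_deriv h (cis t)"
        and f' = f' and \<epsilon> = \<epsilon>])
    show "(H has_real_derivative angular_deriv h (cis t)) (at t)" for t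
      using h(2) by (simp add: angular_lift_def)
    show "angular_deriv h (cis t) > 0" for t
      by (rule angular_pos[OF h(1)]) simp
    show "t < H t" if "t0 - \<epsilon> < t" "t < t0" for t
      using H that by simp
    show "1 / C > 0" using C by simp
  qed (fact h f' \<epsilon>)+
  then obtain \<delta> where \<delta>: "\<delta> > 0" "\<forall>t. t0 - \<delta> < t \<and> t < t0 \<longrightarrow>
      (\<exists>n s. (H ^^ n) s = t \<and> (\<Prod>k<n. angular_deriv h (cis ((H ^^ k) s))) < 1 / C)"
    by (elim exE conjE) (rule that)
  show ?thesis
  proof (intro exI[of _ \<delta>] conjI allI impI)
    fix t assume "t0 - \<delta> < t \<and> t < t0"
    with \<delta>(2) obtain n s where "(H ^^ n) s = t"
      "(\<Prod>k<n. angular_deriv h (cis ((H ^^ k) s))) < 1 / C"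
      by (elim allE[of _ t] impE exE conjE) (simp, rule that)
    thus "\<exists>h\<in>G. angular_deriv h (cis t) > C" by (rule ex_large_deriv[OF h(1,2) C])
  qed (fact \<delta>(1))
qed

section \<open>Derivatives measured in a metric\<close>

text \<open>Changing the metric multiplies the derivative by a ratio of norms of the frame at
  \<open>g x\<close> and at \<open>x\<close>. Such ratios cancel in the chain rule and are bounded
  independently of \<open>g\<close>.\<close>

lemma metric_deriv_eq:
  assumes "riemannian_metric m" "g \<in> G" "x \<in> circle"
  shows "metric_deriv m g x =
    angular_deriv g x * metric_norm m (g x) (\<i> * g x) / metric_norm m x (\<i> * x)"
proof -
  have "metric_norm m (g x) (push_unit_tangent g x) =
      angular_deriv g x * metric_norm m (g x) (\<i> * g x)"
    unfolding push_unit_tangent_eq(2)[OF orient[OF assms(2)] assms(3) maps_circle[OF assms(2,3)]]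
    by (rule metric_norm_scaleR[OF assms(1) maps_circle[OF assms(2,3)] i_mult_in_tangent_line
        less_imp_le[OF angular_pos[OF assms(2,3)]]])
  thus ?thesis by (simp add: metric_deriv_def)
qed

lemma metric_deriv_pos:
  assumes "riemannian_metric m" "g \<in> G" "x \<in> circle"
  shows "metric_deriv m g x > 0"
  unfolding metric_deriv_eq[OF assms]
  by (rule divide_pos_pos[OF mult_pos_pos[OF angular_pos[OF assms(2,3)]
        metric_norm_unit_pos[OF assms(1) maps_circle[OF assms(2,3)]]]
        metric_norm_unit_pos[OF assms(1,3)]])

lemma metric_deriv_comp:
  assumes "riemannian_metric m" "f \<in> G" "g \<in> G" "h \<in> G" "\<And>x. x \<in> circle \<Longrightarrow> h x = f (g x)"
    and "x \<in> circle"
  shows "metric_deriv m h x = metric_deriv m f (g x) * metric_deriv m g x"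
proof -
  have "metric_norm m (g x) (\<i> * g x) > 0"
    by (rule metric_norm_unit_pos[OF assms(1) maps_circle[OF assms(3,6)]])
  thus ?thesis
    using assms maps_circle[OF assms(3,6)] angular_deriv_comp[OF assms(2,3,5,6)]
    by (simp add: metric_deriv_eq)
qed

lemma isCont_metric_deriv:
  assumes "riemannian_metric m" "g \<in> G"
  shows "isCont (\<lambda>t. metric_deriv m g (cis t)) t"
proof -
  obtain F where F: "angular_lift g F" using ex_lift[OF assms(2)] .
  obtain f' where f': "\<And>t. ((\<lambda>t. angular_deriv g (cis t)) has_real_derivative f' t) (at t)"
    by (rule ex_C1_angular_deriv[OF assms(2)]) (rule that)
  define r where "r t = metric_norm m (cis t) (\<i> * cis t)" for t
  have r: "isCont r t" for t
    using continuous_metric_norm_unit[OF assms(1)]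
    by (simp add: r_def[abs_def] continuous_on_eq_continuous_at)
  have "r t > 0" for t unfolding r_def by (rule metric_norm_unit_pos[OF assms(1)]) simp
  hence "r t \<noteq> 0" by (simp add: less_imp_neq[symmetric])
  moreover have "isCont (\<lambda>t. angular_deriv g (cis t)) t" by (rule DERIV_isCont[OF f'])
  moreover have "isCont (\<lambda>t. r (F t)) t" using lift_isCont[OF F] r by (rule isCont_o2)
  ultimately have "isCont (\<lambda>t. angular_deriv g (cis t) * r (F t) / r t) t"
    using r by (intro continuous_intros)
  moreover have "metric_deriv m g (cis t) = angular_deriv g (cis t) * r (F t) / r t" for t
    using metric_deriv_eq[OF assms, of "cis t"] F by (simp add: r_def angular_lift_def)
  ultimately show ?thesis by simp
qed

section \<open>Non-expandable points\<close>

text \<open>Of the two maps provided by property \<open>(\<star>)\<close>, \<open>gp\<close> takes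
  care of the points to the right of \<open>t0\<close> and \<open>gm\<close> of those to the
  left.\<close>

lemma NE_repelling:
  assumes m: "riemannian_metric m" and star: "property_star m G" and t0: "cis t0 \<in> NE m G"
    and C: "C > 0"
  obtains \<delta> where "\<delta> > 0"
    "\<And>t. \<bar>t - t0\<bar> < \<delta> \<Longrightarrow> t \<noteq> t0 \<Longrightarrow> \<exists>g\<in>G. metric_deriv m g (cis t) > C"
proof -
  obtain a b where ab: "a > 0" "b > 0" "\<And>x. x \<in> circle \<Longrightarrow> a \<le> metric_norm m x (\<i> * x)"
    "\<And>x. x \<in> circle \<Longrightarrow> metric_norm m x (\<i> * x) \<le> b"
    by (rule metric_norm_unit_bounds[OF m]) (rule that)
  \<comment> \<open>The ratio of the frame norms is at least \<open>a / b\<close>, so an angular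
    derivative above \<open>C * b / a\<close> is enough.\<close>
  have large: "\<exists>g\<in>G. metric_deriv m g (cis t) > C"
    if large: "\<exists>g\<in>G. angular_deriv g (cis t) > C * b / a" for t
  proof -
    obtain g where g: "g \<in> G" "angular_deriv g (cis t) > C * b / a" using large by blast
    have gt: "g (cis t) \<in> circle" by (rule maps_circle[OF g(1)]) simp
    have "C = (C * b / a) * a / b" using ab by simp
    also have "\<dots> < angular_deriv g (cis t) * a / b"
      using ab g(2) by (intro divide_strict_right_mono mult_strict_right_mono) auto
    also have "\<dots> \<le> angular_deriv g (cis t) * metric_norm m (g (cis t)) (\<i> * g (cis t)) /
        metric_norm m (cis t) (\<i> * cis t)"
      using ab(1,2) ab(3)[OF gt] ab(4)[of "cis t"] angular_pos[OF g(1), of "cis t"]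
        metric_norm_unit_pos[OF m, of "cis t"]
      by (intro frac_le mult_left_mono mult_nonneg_nonneg) auto
    also have "\<dots> = metric_deriv m g (cis t)"
      using metric_deriv_eq[OF m g(1), of "cis t"] by simp
    finally show ?thesis using g(1) by blast
  qed
  obtain gp gm \<epsilon> where gp: "gp \<in> G" "gp (cis t0) = cis t0" and gm: "gm \<in> G" "gm (cis t0) = cis t0"
    and \<epsilon>: "\<epsilon> > 0" "\<forall>y\<in>circle_arc (cis t0) 0 \<epsilon>. gp y \<noteq> y"
      "\<forall>y\<in>circle_arc (cis t0) (-\<epsilon>) 0. gm y \<noteq> y"
    using star[unfolded property_star_def, THEN conjunct2, THEN bspec, OF t0]
    by (elim bexE conjE exE) (rule that)
  have CC: "C * b / a > 0" using ab C by simp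
  obtain \<delta>1 where \<delta>1: "\<delta>1 > 0"
    "\<forall>t. t0 < t \<and> t < t0 + \<delta>1 \<longrightarrow> (\<exists>g\<in>G. angular_deriv g (cis t) > C * b / a)"
    using ex_large_deriv_right[OF gp \<epsilon>(1,2) CC] by (elim exE conjE) (rule that)
  obtain \<delta>2 where \<delta>2: "\<delta>2 > 0"
    "\<forall>t. t0 - \<delta>2 < t \<and> t < t0 \<longrightarrow> (\<exists>g\<in>G. angular_deriv g (cis t) > C * b / a)"
    using ex_large_deriv_left[OF gm \<epsilon>(1,3) CC] by (elim exE conjE) (rule that)
  show ?thesis
  proof (rule that[of "min \<delta>1 \<delta>2"])
    fix t assume "\<bar>t - t0\<bar> < min \<delta>1 \<delta>2" "t \<noteq> t0"
    hence "t0 < t \<and> t < t0 + \<delta>1 \<or> t0 - \<delta>2 < t \<and> t < t0" by linarith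
    hence "\<exists>g\<in>G. angular_deriv g (cis t) > C * b / a"
      using \<delta>1(2)[rule_format, of t] \<delta>2(2)[rule_format, of t] by (elim disjE) simp_all
    thus "\<exists>g\<in>G. metric_deriv m g (cis t) > C" by (rule large)
  qed (use \<delta>1 \<delta>2 in simp)
qed

text \<open>It is not known beforehand that the supremum \<open>M\<close> of the derivatives at
  \<open>x\<close> is attained. The repelling property of the limit point forces the approximating
  orbit points onto it.\<close>

lemma bounded_deriv_imp_orbit_NE:
  assumes m: "riemannian_metric m" and star: "property_star m G" and x: "x \<in> circle"
    and bdd: "\<And>g. g \<in> G \<Longrightarrow> metric_deriv m g x \<le> B"
  shows "\<exists>h\<in>G. h x \<in> NE m G"
proof -
  define D where "D g = metric_deriv m g x" for g
  define M where "M = (SUP g\<in>G. D g)"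
  obtain e where e: "e \<in> G" using ex_id by blast
  have bdd_above: "bdd_above (D ` G)" using bdd by (auto simp: D_def intro!: bdd_aboveI2)
  have D_le: "D g \<le> M" if "g \<in> G" for g
    unfolding M_def by (rule cSUP_upper[OF that bdd_above])
  have "M > 0" using D_le[OF e] metric_deriv_pos[OF m e x] by (simp add: D_def)
  \<comment> \<open>\<open>Suc n\<close> matters: since \<open>1 / 0 = 0\<close>, the index 0 would
    otherwise demand an element with \<open>M < D h\<close>.\<close>
  have "\<exists>h\<in>G. M / (1 + 1 / real (Suc n)) < D h" for n
  proof -
    have "M / (1 + 1 / real (Suc n)) < M"
      using \<open>M > 0\<close> by (simp add: field_simps add_pos_nonneg)
    also have "M = Sup (D ` G)" by (simp only: M_def)
    finally show ?thesis using e by (auto elim!: less_cSupE)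
  qed
  then obtain h where h: "\<And>n. h n \<in> G" "\<And>n. M / (1 + 1 / real (Suc n)) < D (h n)"
    by metis
  define y where "y n = h n x" for n
  have y: "y n \<in> circle" for n unfolding y_def by (rule maps_circle[OF h(1) x])
  \<comment> \<open>Applying \<open>g\<close> after \<open>h n\<close> cannot push the derivative at
    \<open>x\<close> above \<open>M\<close>, and \<open>h n\<close> alone already nearly reaches
    \<open>M\<close>.\<close>
  have deriv_y: "metric_deriv m g (y n) \<le> 1 + 1 / real (Suc n)" if g: "g \<in> G" for g n
  proof -
    obtain k where k: "k \<in> G" "\<And>x. x \<in> circle \<Longrightarrow> k x = g (h n x)"
      using ex_comp[OF g h(1)] by blast
    have pos: "D (h n) > 0" unfolding D_def by (rule metric_deriv_pos[OF m h(1) x])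
    have "metric_deriv m g (y n) * D (h n) = D k"
      using metric_deriv_comp[OF m g h(1) k x] by (simp add: D_def y_def)
    also have "\<dots> \<le> M" by (rule D_le[OF k(1)])
    also have "M \<le> (1 + 1 / real (Suc n)) * D (h n)"
      using h(2)[of n] by (simp add: field_simps)
    finally show ?thesis using pos by simp
  qed
  define t where "t n = Arg (y n)" for n
  have cis_t: "cis (t n) = y n" for n unfolding t_def by (rule circle_cis_Arg[OF y])
  have "t n \<in> {-pi..pi}" for n using Arg_bounded[of "y n"] by (simp add: t_def)
  then obtain t0 r where r: "strict_mono r" "(t \<circ> r) \<longlonglongrightarrow> t0"
    using compact_Icc[of "-pi" pi] unfolding compact_def by metis
  have "metric_deriv m g (cis t0) \<le> 1" if g: "g \<in> G" for g
  proof (rule LIMSEQ_le)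
    show "(\<lambda>n. metric_deriv m g (cis ((t \<circ> r) n))) \<longlonglongrightarrow> metric_deriv m g (cis t0)"
      by (rule isCont_tendsto_compose[OF isCont_metric_deriv[OF m g] r(2)])
    have "(\<lambda>n. 1 + 1 / real (Suc n)) \<longlonglongrightarrow> 1 + 0"
      by (intro tendsto_add tendsto_const LIMSEQ_Suc[OF lim_1_over_n])
    from LIMSEQ_subseq_LIMSEQ[OF this r(1)]
    show "(\<lambda>n. 1 + 1 / real (Suc (r n))) \<longlonglongrightarrow> 1" by (simp add: o_def)
    show "\<exists>N. \<forall>n\<ge>N. metric_deriv m g (cis ((t \<circ> r) n)) \<le> 1 + 1 / real (Suc (r n))"
      using deriv_y[OF g] by (simp add: cis_t)
  qed
  hence NE: "cis t0 \<in> NE m G" by (simp add: NE_def)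
  \<comment> \<open>The threshold 2 is the largest value of \<open>1 + 1 / real (Suc n)\<close>. So
    an orbit point within \<open>\<delta>\<close> of the limit but different from it would
    contradict \<open>deriv_y\<close>.\<close>
  obtain \<delta> where \<delta>: "\<delta> > 0"
    "\<And>t. \<bar>t - t0\<bar> < \<delta> \<Longrightarrow> t \<noteq> t0 \<Longrightarrow> \<exists>g\<in>G. metric_deriv m g (cis t) > 2"
    using NE_repelling[OF m star NE, of 2] by auto
  obtain n where n: "\<bar>t (r n) - t0\<bar> < \<delta>"
    using r(2) \<delta>(1) unfolding LIMSEQ_iff by (metis comp_apply order_refl real_norm_def)
  have "t (r n) = t0"
  proof (rule ccontr)
    assume "t (r n) \<noteq> t0"
    then obtain g where g: "g \<in> G" "metric_deriv m g (y (r n)) > 2"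
      using \<delta>(2)[OF n] unfolding cis_t by blast
    have "1 / real (Suc (r n)) \<le> 1" by simp
    thus False using deriv_y[OF g(1), of "r n"] g(2) by linarith
  qed
  hence "h (r n) x \<in> NE m G" using NE cis_t[of "r n"] by (simp add: y_def)
  thus ?thesis by (rule bexI[OF _ h(1)])
qed

text \<open>The bound 1 in \<open>m'\<close> bounds the angular derivative, which in turn bounds the
  derivative in \<open>m\<close>; the constants depend on \<open>x\<close> and the metrics but not
  on \<open>g\<close>.\<close>

lemma NE_imp_bounded_deriv:
  assumes m: "riemannian_metric m" and m': "riemannian_metric m'" and x: "x \<in> NE m' G"
  shows "\<exists>B. \<forall>g\<in>G. metric_deriv m g x \<le> B"
proof -
  obtain b where b: "b > 0" "\<And>x. x \<in> circle \<Longrightarrow> metric_norm m x (\<i> * x) \<le> b"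
    by (rule metric_norm_unit_bounds[OF m]) (rule that)
  obtain a' where a': "a' > 0" "\<And>x. x \<in> circle \<Longrightarrow> a' \<le> metric_norm m' x (\<i> * x)"
    by (rule metric_norm_unit_bounds[OF m']) (rule that)
  define n where "n = metric_norm m x (\<i> * x)"
  define n' where "n' = metric_norm m' x (\<i> * x)"
  have xc: "x \<in> circle" using x by (simp add: NE_def)
  have pos: "n > 0" "n' > 0" unfolding n_def n'_def by (intro metric_norm_unit_pos m m' xc)+
  have "metric_deriv m g x \<le> n' / a' * b / n" if g: "g \<in> G" for g
  proof -
    note gx = maps_circle[OF g xc]
    have ang: "angular_deriv g x > 0" by (rule angular_pos[OF g xc])
    have "angular_deriv g x * a' \<le> angular_deriv g x * metric_norm m' (g x) (\<i> * g x)"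
      using ang a'(2)[OF gx] by (intro mult_left_mono) auto
    also have "metric_deriv m' g x \<le> 1" using x g by (simp add: NE_def)
    hence "angular_deriv g x * metric_norm m' (g x) (\<i> * g x) \<le> n'"
      unfolding metric_deriv_eq[OF m' g xc] n'_def[symmetric] using pos(2)
      by (simp add: pos_divide_le_eq)
    finally have "angular_deriv g x \<le> n' / a'" using a'(1) by (simp add: pos_le_divide_eq)
    hence *: "angular_deriv g x * metric_norm m (g x) (\<i> * g x) \<le> n' / a' * b"
      using b(2)[OF gx] a'(1) pos metric_norm_unit_pos[OF m gx] by (intro mult_mono) auto
    show ?thesis
      unfolding metric_deriv_eq[OF m g xc] n_def[symmetric]
      using pos by (intro divide_right_mono *) simp
  qed
  thus ?thesis by blast
qed

section \<open>Transport of fixed points and arcs by conjugation\<close>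

text \<open>A lift of \<open>h\<close> is continuous and strictly increasing, so \<open>h\<close>
  maps short arcs on one side of \<open>x\<close> into short arcs on the same side of
  \<open>h x\<close>.\<close>

lemma arc_image:
  assumes h: "h \<in> G" and x: "x \<in> circle" and \<epsilon>: "\<epsilon> > 0"
  obtains \<delta> where "\<delta> > 0" "h ` circle_arc x 0 \<delta> \<subseteq> circle_arc (h x) 0 \<epsilon>"
    "h ` circle_arc x (-\<delta>) 0 \<subseteq> circle_arc (h x) (-\<epsilon>) 0"
proof -
  define t0 where "t0 = Arg x"
  have x_eq: "x = cis t0" using circle_cis_Arg[OF x] by (simp add: t0_def)
  obtain H where H: "angular_lift h H" using ex_lift[OF h] .
  have lift: "h (cis t) = cis (H t)" for t using H by (simp add: angular_lift_def)
  obtain \<delta> where \<delta>: "\<delta> > 0" "\<And>t. \<bar>t - t0\<bar> < \<delta> \<Longrightarrow> \<bar>H t - H t0\<bar> < \<epsilon>"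
    using lift_isCont[OF H, of t0] \<epsilon> unfolding continuous_at_eps_delta dist_real_def by metis
  have arc: "h (x * cis s) = h x * cis (H (t0 + s) - H t0)" for s
    by (simp add: x_eq cis_mult lift)
  have bd: "\<bar>H (t0 + s) - H t0\<bar> < \<epsilon>" if "\<bar>s\<bar> < \<delta>" for s
    using \<delta>(2)[of "t0 + s"] that by simp
  show ?thesis
  proof (rule that[OF \<delta>(1)])
    show "h ` circle_arc x 0 \<delta> \<subseteq> circle_arc (h x) 0 \<epsilon>"
    proof (rule image_subsetI)
      fix y assume "y \<in> circle_arc x 0 \<delta>"
      then obtain s where "y = x * cis s" "0 < s" "s < \<delta>" by (auto simp: circle_arc_def)
      thus "h y \<in> circle_arc (h x) 0 \<epsilon>"
        using bd[of s] lift_strict_mono[OF h H, of t0 "t0 + s"] unfolding circle_arc_def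
        by (auto simp: arc intro!: exI[of _ "H (t0 + s) - H t0"])
    qed
    show "h ` circle_arc x (-\<delta>) 0 \<subseteq> circle_arc (h x) (-\<epsilon>) 0"
    proof (rule image_subsetI)
      fix y assume "y \<in> circle_arc x (-\<delta>) 0"
      then obtain s where "y = x * cis s" "- \<delta> < s" "s < 0" by (auto simp: circle_arc_def)
      thus "h y \<in> circle_arc (h x) (-\<epsilon>) 0"
        using bd[of s] lift_strict_mono[OF h H, of "t0 + s" t0] unfolding circle_arc_def
        by (auto simp: arc intro!: exI[of _ "H (t0 + s) - H t0"])
    qed
  qed
qed

end

lemma circle_arc_subset: "x \<in> circle \<Longrightarrow> circle_arc x a b \<subseteq> circle"
  by (auto simp: circle_arc_def norm_mult)

theorem corollary1p10:
  fixes G :: "(complex \<Rightarrow> complex) set"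
    and m m' :: "complex \<Rightarrow> complex \<Rightarrow> complex \<Rightarrow> real"
  assumes "C2_diffeo_group G"
    and "finitely_generated (BijGroup circle) G"
    and "riemannian_metric m"
    and "riemannian_metric m'"
    and "property_star m G"
  shows "property_star m' G"
proof -
  interpret C2_circle_group G by unfold_locales fact
  have "\<exists>gp\<in>G. \<exists>gm\<in>G. gp x = x \<and> gm x = x \<and>
      (\<exists>\<epsilon>>0. (\<forall>y\<in>circle_arc x 0 \<epsilon>. gp y \<noteq> y) \<and> (\<forall>y\<in>circle_arc x (-\<epsilon>) 0. gm y \<noteq> y))"
    if xNE: "x \<in> NE m' G" for x
  proof -
    have x: "x \<in> circle" using xNE by (simp add: NE_def)
    obtain h where h: "h \<in> G" "h x \<in> NE m G"
      using bounded_deriv_imp_orbit_NE[OF assms(3,5) x]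
        NE_imp_bounded_deriv[OF assms(3,4) xNE] by blast
    obtain gp gm \<epsilon> where g: "gp \<in> G" "gm \<in> G" and fixed: "gp (h x) = h x" "gm (h x) = h x"
      and \<epsilon>: "\<epsilon> > 0" "\<forall>y\<in>circle_arc (h x) 0 \<epsilon>. gp y \<noteq> y"
        "\<forall>y\<in>circle_arc (h x) (-\<epsilon>) 0. gm y \<noteq> y"
      using assms(5)[unfolded property_star_def, THEN conjunct2, THEN bspec, OF h(2)]
      by (elim bexE conjE exE) (rule that)
    obtain kp where kp: "kp \<in> G" "\<And>y. y \<in> circle \<Longrightarrow> h (kp y) = gp (h y)"
      using ex_conj[OF g(1) h(1)] by blast
    obtain km where km: "km \<in> G" "\<And>y. y \<in> circle \<Longrightarrow> h (km y) = gm (h y)"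
      using ex_conj[OF g(2) h(1)] by blast
    obtain \<delta> where \<delta>: "\<delta> > 0" "h ` circle_arc x 0 \<delta> \<subseteq> circle_arc (h x) 0 \<epsilon>"
      "h ` circle_arc x (-\<delta>) 0 \<subseteq> circle_arc (h x) (-\<epsilon>) 0"
      by (rule arc_image[OF h(1) x \<epsilon>(1)]) (rule that)
    \<comment> \<open>\<open>h (kp x) = gp (h x) = h x\<close>, and \<open>h\<close> is injective on
      the circle; likewise for \<open>km\<close>.\<close>
    have "kp x = x" "km x = x"
      using kp km fixed x eq_iff[OF h(1)] maps_circle by metis+
    \<comment> \<open>If \<open>kp\<close> fixed \<open>y\<close>, then \<open>gp\<close> would fix
      \<open>h y\<close>, which lies in the arc at \<open>h x\<close> without fixed points of
      \<open>gp\<close>.\<close>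
    moreover have "\<forall>y\<in>circle_arc x 0 \<delta>. kp y \<noteq> y"
      using kp(2) circle_arc_subset[OF x] \<epsilon>(2) \<delta>(2) by (metis image_subset_iff subsetD)
    moreover have "\<forall>y\<in>circle_arc x (-\<delta>) 0. km y \<noteq> y"
      using km(2) circle_arc_subset[OF x] \<epsilon>(3) \<delta>(3) by (metis image_subset_iff subsetD)
    ultimately show ?thesis
      by (intro bexI[OF _ kp(1)] bexI[OF _ km(1)] conjI exI[of _ \<delta>] \<delta>(1))
  qed
  \<comment> \<open>Minimality does not mention the metric, so it carries over from \<open>m\<close>
    unchanged.\<close>
  thus ?thesis using assms(5) by (simp add: property_star_def)
qed

end
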